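(* Let $R$ be the amplification map of MIISO2, MIISO3, or MIISO4 with cutoff $\omega_c>0$ and dissipative parent $R_D$. If $|z|\ge\omega_c$, then $R(z)=R_D(z)$. Hence $R(z)\to0$ as $|z|\to\infty$ in the left half-plane $\{\mathrm{Re}(z)\le0\}$.
   Context: Padé approximants. $[m/n]=P_{m,n}/Q_{m,n}$ is the Padé approximant of $e^z$: $\deg P_{m,n}=m$, $\deg Q_{m,n}=n$, $Q_{m,n}(0)=1$, $[m/n](z)-e^z=O(z^{m+n+1})$. $[0/N]=1/Q_N$ with $Q_N(z)=\sum_{j=0}^N(-z)^j/j!$; $[1/2](z)=\frac{1+z/3}{1-2z/3+z^2/6}$, $[1/3](z)=\frac{1+z/4}{1-3z/4+z^2/4-z^3/24}$. Repaired dissipative map. For $N\in\{3,4\}$ let $\mathcal{W}_N=\{\mathrm{Re}(z)\le0,\ |Q_N(z)|<1\}$, $R_{\mathrm{raw}}=[0/N]$, $R_{\mathrm{fix}}=[1/(N-1)]$, $\delta=0.10$, $\omega_*=\sqrt3$ ($N=3$) or $\sqrt8$ ($N=4$); for $0<|y|<\omega_*$ let $x_b(y)<0$ be the unique negative root $x$ of $|Q_N(x+iy)|=1$. The weight $\theta_{\mathrm{wedge}}(z)\in[0,1]$ equals $1$ on $\mathcal{W}_N$ and at the origin, decreases linearly to $0$ across a transition pad around $\mathcal{W}_N$ with outer edge $\mathrm{Re}(z)=(1+\delta)x_b(\mathrm{Im}(z))$ or $|\mathrm{Im}(z)|=(1+\delta)\omega_*$, and is $0$ outside (in particular for all large $|z|$).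 With $\theta=\theta_{\mathrm{wedge}}(z)$, $R_D(z)=|R_{\mathrm{fix}}(z)|^{\theta}|R_{\mathrm{raw}}(z)|^{1-\theta}\exp(i[(1-\theta)\arg R_{\mathrm{raw}}(z)+\theta\arg R_{\mathrm{fix}}(z)])$, continuous branches of $\arg$ vanishing at $0$; $R_D=R_{\mathrm{raw}}$ where $\theta=0$ and $R_D=R_{\mathrm{fix}}$ where $\theta=1$. Amplification map. Parents: MIISO2: $R_C=[1/1]$, $R_D=[0/2]$; MIISO3: $R_C=[2/2]$, $R_D$ the repaired map with $N=3$; MIISO4: $R_C=[2/2]$, $R_D$ the repaired map with $N=4$. Fix $r\in(0,1)$ and an integer $s>1$ (defaults $r=0.99$, $s=4$), $\omega_0=r\omega_c$, and the taper $\theta(\omega)=0$ for $\omega\le\omega_0$, $\bigl(\frac{\omega-\omega_0}{\omega_c-\omega_0}\bigr)^s$ for $\omega_0<\omega<\omega_c$, $1$ for $\omega\ge\omega_c$. Then $R(z)=|R_D(z)|^{\theta(|z|)}|R_C(z)|^{1-\theta(|z|)}\exp(i[(1-\theta(|z|))\arg R_C(z)+\theta(|z|)\arg R_D(z)])$, with $R=R_C$ where $\theta=0$ and $R=R_D$ where $\theta=1$. *)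

theory Defs
  imports "HOL-Analysis.Analysis" "HOL-Library.Landau_Symbols"
    "HOL-Computational_Algebra.Polynomial"
begin

definition is_pade :: "nat \<Rightarrow> nat \<Rightarrow> complex poly \<Rightarrow> complex poly \<Rightarrow> bool" where
  "is_pade m n P Q \<longleftrightarrow> degree P = m \<and> degree Q = n \<and> poly Q 0 = 1 \<and>
     (\<lambda>z. poly P z / poly Q z - exp z) \<in> O[at 0](\<lambda>z. z ^ (m + n + 1))"

(* The pair (P, Q) exists and is unique.  By the convention w / 0 = 0, a Pade approximant
   takes the value 0 at its poles. *)
definition pade :: "nat \<Rightarrow> nat \<Rightarrow> complex \<Rightarrow> complex" where
  "pade m n z = (case (SOME PQ. is_pade m n (fst PQ) (snd PQ)) of (P, Q) \<Rightarrow> poly P z / poly Q z)"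

definition Qden :: "nat \<Rightarrow> complex \<Rightarrow> complex" where
  "Qden N z = (\<Sum>j\<le>N. (- z) ^ j / fact j)"

(* The points z such that f has neither a zero nor a pole on the segment from 0 to z: poles are
   excluded by the condition f \<noteq> 0 because f takes the value 0 there.  This set is star-shaped
   about 0, so for f 0 = 1 the continuous branch of arg f vanishing at 0 exists and is unique
   on it. *)
definition arg_domain :: "(complex \<Rightarrow> complex) \<Rightarrow> complex set" where
  "arg_domain f = {z. \<forall>t\<in>{0..1}. f (of_real t * z) \<noteq> 0}"

(* Nothing is prescribed off the star-shaped domain, i.e. on the cuts running radially outwards
   from the zeros and poles of f. *)
definition arg_branch :: "(complex \<Rightarrow> complex) \<Rightarrow> (complex \<Rightarrow> real) \<Rightarrow> bool" where
  "arg_branch f A \<longleftrightarrow> A 0 = 0 \<and> continuous_on (arg_domain f) A \<and>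
     (\<forall>z\<in>arg_domain f. f z = of_real (cmod (f z)) * exp (\<i> * of_real (A z)))"

definition blend_arg :: "(complex \<Rightarrow> real) \<Rightarrow> (complex \<Rightarrow> real) \<Rightarrow> (complex \<Rightarrow> real) \<Rightarrow> complex \<Rightarrow> real" where
  "blend_arg \<theta> a\<^sub>1 a\<^sub>0 z = (1 - \<theta> z) * a\<^sub>0 z + \<theta> z * a\<^sub>1 z"

(* f\<^sub>1 (with argument a\<^sub>1) is the map attained at \<theta> = 1, f\<^sub>0 (with argument a\<^sub>0) the one at
   \<theta> = 0.  The end cases are separate because 0 powr 0 = 0. *)
definition blend :: "(complex \<Rightarrow> real) \<Rightarrow> (complex \<Rightarrow> complex) \<Rightarrow> (complex \<Rightarrow> real) \<Rightarrow>
    (complex \<Rightarrow> complex) \<Rightarrow> (complex \<Rightarrow> real) \<Rightarrow> complex \<Rightarrow> complex" where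
  "blend \<theta> f\<^sub>1 a\<^sub>1 f\<^sub>0 a\<^sub>0 z =
     (if \<theta> z = 0 then f\<^sub>0 z
      else if \<theta> z = 1 then f\<^sub>1 z
      else of_real (cmod (f\<^sub>1 z) powr \<theta> z * cmod (f\<^sub>0 z) powr (1 - \<theta> z))
             * exp (\<i> * of_real (blend_arg \<theta> a\<^sub>1 a\<^sub>0 z)))"

definition wedge :: "nat \<Rightarrow> complex set" where
  "wedge N = {z. Re z \<le> 0 \<and> cmod (Qden N z) < 1}"

definition pad_width :: real where
  "pad_width = 1 / 10"

definition omega_star :: "nat \<Rightarrow> real" where
  "omega_star N = (if N = 3 then sqrt 3 else sqrt 8)"

definition x_b :: "nat \<Rightarrow> real \<Rightarrow> real" where
  "x_b N y = (THE x. x < 0 \<and> cmod (Qden N (Complex x y)) = 1)"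

(* The pad around the wedge has two kinds of parts.  For 0 < |y| < omega_star N the weight is
   affine in x between the wedge boundary x = x_b N y and the outer edge
   x = (1 + pad_width) * x_b N y.  For omega_star N \<le> |y| \<le> (1 + pad_width) * omega_star N it
   is affine in |y|, from its value at height omega_star N down to 0.  The tips
   \<plusminus> \<i> * omega_star N are the ends of the wedge, so the weight is 1 there.  The horizontal
   extent of the second part is not prescribed, except that the pad does not reach further left
   than the outer edge (1 + pad_width) * x_b N does. *)
definition wedge_weight :: "nat \<Rightarrow> (complex \<Rightarrow> real) \<Rightarrow> bool" where
  "wedge_weight N \<theta> \<longleftrightarrow>
     (\<forall>z. 0 \<le> \<theta> z \<and> \<theta> z \<le> 1) \<and>
     (\<forall>z\<in>insert 0 (wedge N). \<theta> z = 1) \<and>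
     (\<forall>x y. 0 < \<bar>y\<bar> \<and> \<bar>y\<bar> < omega_star N \<and> (1 + pad_width) * x_b N y \<le> x \<and> x \<le> x_b N y \<longrightarrow>
        \<theta> (Complex x y) = ((1 + pad_width) * x_b N y - x) / (pad_width * x_b N y)) \<and>
     (\<forall>y. \<bar>y\<bar> = omega_star N \<longrightarrow> \<theta> (Complex 0 y) = 1) \<and>
     (\<forall>x y. x \<le> 0 \<and> omega_star N \<le> \<bar>y\<bar> \<and> \<bar>y\<bar> \<le> (1 + pad_width) * omega_star N \<longrightarrow>
        \<theta> (Complex x y) = \<theta> (Complex x (sgn y * omega_star N))
          * (((1 + pad_width) * omega_star N - \<bar>y\<bar>) / (pad_width * omega_star N))) \<and>
     (\<forall>z. Re z > 0
        \<or> \<bar>Im z\<bar> \<ge> (1 + pad_width) * omega_star N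
        \<or> Im z = 0 \<and> z \<noteq> 0
        \<or> 0 < \<bar>Im z\<bar> \<and> \<bar>Im z\<bar> < omega_star N \<and> Re z \<le> (1 + pad_width) * x_b N (Im z)
        \<or> Re z < 0 \<and> (\<forall>y. 0 < \<bar>y\<bar> \<and> \<bar>y\<bar> < omega_star N \<longrightarrow> Re z \<le> (1 + pad_width) * x_b N y)
        \<longrightarrow> \<theta> z = 0)"

(* The repaired map R together with its argument, for which the phase of the defining
   exponential is taken. *)
definition repaired_map :: "nat \<Rightarrow> (complex \<Rightarrow> complex) \<Rightarrow> (complex \<Rightarrow> real) \<Rightarrow> bool" where
  "repaired_map N R a \<longleftrightarrow>
     (\<exists>\<theta> a_raw a_fix. wedge_weight N \<theta> \<and>
        arg_branch (pade 0 N) a_raw \<and> arg_branch (pade 1 (N - 1)) a_fix \<and>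
        R = blend \<theta> (pade 1 (N - 1)) a_fix (pade 0 N) a_raw \<and>
        a = blend_arg \<theta> a_fix a_raw)"

datatype scheme = MIISO2 | MIISO3 | MIISO4

fun conservative_parent :: "scheme \<Rightarrow> complex \<Rightarrow> complex" where
  "conservative_parent MIISO2 = pade 1 1"
| "conservative_parent MIISO3 = pade 2 2"
| "conservative_parent MIISO4 = pade 2 2"

fun dissipative_parent :: "scheme \<Rightarrow> (complex \<Rightarrow> complex) \<Rightarrow> (complex \<Rightarrow> real) \<Rightarrow> bool" where
  "dissipative_parent MIISO2 R a \<longleftrightarrow> R = pade 0 2 \<and> arg_branch (pade 0 2) a"
| "dissipative_parent MIISO3 R a \<longleftrightarrow> repaired_map 3 R a"
| "dissipative_parent MIISO4 R a \<longleftrightarrow> repaired_map 4 R a"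

definition taper :: "real \<Rightarrow> nat \<Rightarrow> real \<Rightarrow> real \<Rightarrow> real" where
  "taper r s \<omega>\<^sub>c \<omega> =
     (let \<omega>\<^sub>0 = r * \<omega>\<^sub>c in
      if \<omega> \<le> \<omega>\<^sub>0 then 0
      else if \<omega> < \<omega>\<^sub>c then ((\<omega> - \<omega>\<^sub>0) / (\<omega>\<^sub>c - \<omega>\<^sub>0)) ^ s
      else 1)"

definition amplification_map ::
    "scheme \<Rightarrow> real \<Rightarrow> nat \<Rightarrow> real \<Rightarrow> (complex \<Rightarrow> complex) \<Rightarrow> (complex \<Rightarrow> complex) \<Rightarrow> bool" where
  "amplification_map M r s \<omega>\<^sub>c R_D R \<longleftrightarrow>
     (\<exists>a_D a_C. dissipative_parent M R_D a_D \<and> arg_branch (conservative_parent M) a_C \<and>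
        R = blend (\<lambda>z. taper r s \<omega>\<^sub>c (cmod z)) R_D a_D (conservative_parent M) a_C)"

lemma Qden_sq:
  "(cmod (Qden 3 (Complex (-t) y)))\<^sup>2 = 1 - y^4/12 + y^6/36 + (2 + y^4/6) * t
     + (2 + y^2/2 + y^4/12) * t^2 + (4/3 + y^2/3) * t^3 + (7/12 + y^2/12) * t^4 + t^5/6 + t^6/36"
  "(cmod (Qden 4 (Complex (-t) y)))\<^sup>2 = 1 - y^6/72 + y^8/576 + (2 - y^4/12 + y^6/72) * t
     + (2 + y^4/24 + y^6/144) * t^2 + (4/3 + y^2/6 + y^4/24) * t^3
     + (2/3 + y^2/8 + y^4/96) * t^4 + (1/4 + y^2/24) * t^5 + (5/72 + y^2/144) * t^6
     + t^7/72 + t^8/576"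
proof -
  have w: "- Complex (-t) y = Complex t (-y)" by (simp add: complex_eq_iff)
  have p2: "(Complex t (-y))^2 = Complex (t^2 - y^2) (-2*t*y)"
    by (simp add: complex_eq_iff power2_eq_square)
  have p3: "(Complex t (-y))^3 = Complex (t^3 - 3*t*y^2) (-3*t^2*y + y^3)"
    by (simp add: complex_eq_iff power2_eq_square power3_eq_cube algebra_simps)
  have p4: "(Complex t (-y))^4 = Complex (t^4 - 6*t^2*y^2 + y^4) (-4*t^3*y + 4*t*y^3)"
    by (simp add: complex_eq_iff eval_nat_numeral algebra_simps)
  have q3: "Qden 3 (Complex (-t) y) = Complex (1 + t + (t^2 - y^2)/2 + (t^3 - 3*t*y^2)/6)
       (- y - t*y + (-3*t^2*y + y^3)/6)"
  proof -
    have "Qden 3 (Complex (-t) y) = 1 + Complex t (-y) + (Complex t (-y))^2 / 2 + (Complex t (-y))^3 / 6"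
      unfolding Qden_def w by (simp add: numeral_3_eq_3 fact_numeral eval_nat_numeral(2,3) del: power_Suc)
    then show ?thesis unfolding p2 p3 by (simp add: complex_eq_iff)
  qed
  have q4: "Qden 4 (Complex (-t) y) = Qden 3 (Complex (-t) y)
      + Complex ((t^4 - 6*t^2*y^2 + y^4)/24) ((-4*t^3*y + 4*t*y^3)/24)"
  proof -
    have "Qden 4 (Complex (-t) y) = Qden 3 (Complex (-t) y) + (Complex t (-y))^4 / fact 4"
      unfolding Qden_def w using sum.atMost_Suc[of "\<lambda>j. Complex t (- y) ^ j / fact j" 3] by simp
    then show ?thesis unfolding p4 by (simp add: complex_eq_iff fact_numeral)
  qed
  show "(cmod (Qden 3 (Complex (-t) y)))\<^sup>2 = 1 - y^4/12 + y^6/36 + (2 + y^4/6) * t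
     + (2 + y^2/2 + y^4/12) * t^2 + (4/3 + y^2/3) * t^3 + (7/12 + y^2/12) * t^4 + t^5/6 + t^6/36"
    unfolding cmod_power2 q3 by (simp add: field_simps eval_nat_numeral)
  show "(cmod (Qden 4 (Complex (-t) y)))\<^sup>2 = 1 - y^6/72 + y^8/576 + (2 - y^4/12 + y^6/72) * t
     + (2 + y^4/24 + y^6/144) * t^2 + (4/3 + y^2/6 + y^4/24) * t^3
     + (2/3 + y^2/8 + y^4/96) * t^4 + (1/4 + y^2/24) * t^5 + (5/72 + y^2/144) * t^6
     + t^7/72 + t^8/576"
    unfolding cmod_power2 q4 q3 by (simp add: field_simps eval_nat_numeral)
qed

lemma lin_coeff_bound: "2 - y^4/12 + y^6/72 \<ge> (14/9::real)"
proof -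
  have "2 - u^2/12 + u^3/72 \<ge> 14/9" if "u \<ge> 0" for u::real
  proof -
    have "(u - 4)^2 * (u + 2) \<ge> 0" using that by simp
    then show ?thesis by (simp add: power2_eq_square power3_eq_cube algebra_simps)
  qed
  from this[of "y^2"] show ?thesis by (simp add: power_mult [symmetric])
qed

lemma const_coeff_bounds: "1 - y^4/12 + y^6/36 \<ge> (8/9::real)" "1 - y^6/72 + y^8/576 \<ge> (1/4::real)"
proof -
  have "1 - u^2/12 + u^3/36 \<ge> 8/9" if "u \<ge> 0" for u::real
  proof -
    have "(u - 2)^2 * (u + 1) \<ge> 0" using that by simp
    then show ?thesis by (simp add: power2_eq_square power3_eq_cube algebra_simps)
  qed
  from this[of "y^2"] show "1 - y^4/12 + y^6/36 \<ge> (8/9::real)" by (simp add: power_mult [symmetric])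
  have "1 - u^3/72 + u^4/576 \<ge> 1/4" if "u \<ge> 0" for u::real
  proof -
    have "u^4 - 8 * u^3 + 432 = (u - 6)^2 * (u^2 + 4 * u + 12)"
      by (simp add: power2_eq_square power3_eq_cube eval_nat_numeral algebra_simps)
    moreover have "(u - 6)^2 * (u^2 + 4 * u + 12) \<ge> 0" using that by simp
    ultimately show ?thesis by (simp add: field_simps)
  qed
  from this[of "y^2"] show "1 - y^6/72 + y^8/576 \<ge> (1/4::real)" by (simp add: power_mult [symmetric])
qed

lemma Qden_mono:
  assumes N: "N \<in> {3, 4}" and "x' < x" "x \<le> 0"
  shows "cmod (Qden N (Complex x y)) < cmod (Qden N (Complex x' y))"
proof -
  define s t where "s = - x" and "t = - x'"
  have st: "0 \<le> s" "s < t" using assms by (auto simp: s_def t_def)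
  have pw: "s ^ k \<le> t ^ k" for k using st by (intro power_mono) auto
  have m: "c * s ^ k \<le> c * t ^ k" if "c \<ge> 0" for c k using pw that by (rule mult_left_mono)
  have c: "(2 + y^4/6) * s < (2 + y^4/6) * t"
    using st by (intro mult_strict_left_mono) (auto intro: add_pos_nonneg)
  have d: "(2 - y^4/12 + y^6/72) * s < (2 - y^4/12 + y^6/72) * t"
    using st lin_coeff_bound[of y] by (intro mult_strict_left_mono) auto
  have "(cmod (Qden N (Complex (-s) y)))\<^sup>2 < (cmod (Qden N (Complex (-t) y)))\<^sup>2"
  proof (cases "N = 3")
    case True
    show ?thesis unfolding True Qden_sq
      using c m[of "2 + y^2/2 + y^4/12" 2] m[of "4/3 + y^2/3" 3] m[of "7/12 + y^2/12" 4] pw[of 5] pw[of 6]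
      by (auto)
  next
    case False
    then have 4: "N = 4" using N by auto
    show ?thesis unfolding 4 Qden_sq
      using d m[of "2 + y^4/24 + y^6/144" 2] m[of "4/3 + y^2/6 + y^4/24" 3] m[of "2/3 + y^2/8 + y^4/96" 4]
        m[of "1/4 + y^2/24" 5] m[of "5/72 + y^2/144" 6] pw[of 7] pw[of 8]
      by (auto)
  qed
  then show ?thesis unfolding s_def t_def using power_less_imp_less_base by fastforce
qed

lemma Qden_axis:
  assumes N: "N \<in> {3, 4}"
  shows "cmod (Qden N (Complex 0 y)) < 1 \<longleftrightarrow> 0 < \<bar>y\<bar> \<and> \<bar>y\<bar> < omega_star N"
proof -
  have sq: "cmod (Qden N (Complex 0 y)) < 1 \<longleftrightarrow> (cmod (Qden N (Complex 0 y)))\<^sup>2 < 1"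
    by (simp add: power_less_one_iff abs_square_less_1)
  show ?thesis
  proof (cases "N = 3")
    case True
    have "(cmod (Qden N (Complex 0 y)))\<^sup>2 = 1 + (y^2)^2 * (y^2 - 3) / 36"
      using Qden_sq(1)[of 0 y] unfolding True by (simp add: field_simps eval_nat_numeral)
    moreover have "(y^2)^2 * (y^2 - 3) < 0 \<longleftrightarrow> y \<noteq> 0 \<and> y^2 < 3" by (auto simp: mult_less_0_iff)
    moreover have "y^2 < 3 \<longleftrightarrow> \<bar>y\<bar> < sqrt 3" using real_sqrt_less_iff[of "y^2" 3] by simp
    ultimately show ?thesis using sq True by (auto simp: omega_star_def)
  next
    case False
    then have 4: "N = 4" using N by auto
    have "(cmod (Qden N (Complex 0 y)))\<^sup>2 = 1 + (y^2)^3 * (y^2 - 8) / 576"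
      using Qden_sq(2)[of 0 y] unfolding 4 by (simp add: field_simps eval_nat_numeral)
    moreover have "(y^2)^3 * (y^2 - 8) < 0 \<longleftrightarrow> y \<noteq> 0 \<and> y^2 < 8" by (auto simp: mult_less_0_iff)
    moreover have "y^2 < 8 \<longleftrightarrow> \<bar>y\<bar> < sqrt 8" using real_sqrt_less_iff[of "y^2" 8] by simp
    ultimately show ?thesis using sq 4 by (auto simp: omega_star_def)
  qed
qed

(* x_b is well defined. *)
lemma x_b_unique:
  assumes N: "N \<in> {3, 4}" and y: "0 < \<bar>y\<bar>" "\<bar>y\<bar> < omega_star N"
  shows "\<exists>!x. x < 0 \<and> cmod (Qden N (Complex x y)) = 1"
proof -
  have 0: "cmod (Qden N (Complex 0 y)) < 1" using Qden_axis[OF N] y by simp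
  have "1 \<le> (cmod (Qden N (Complex (-1) y)))\<^sup>2"
    using lin_coeff_bound[of y] const_coeff_bounds[of y] N Qden_sq[of 1 y] by (auto simp: add_increasing add_increasing2)
  then have 1: "1 \<le> cmod (Qden N (Complex (-1) y))"
    using abs_square_less_1 by (metis abs_norm_cancel linorder_not_le)
  have "continuous_on {-1..0} (\<lambda>x. cmod (Qden N (Complex x y)))"
    unfolding Qden_def Complex_eq by (intro continuous_intros) auto
  then obtain x where x: "-1 \<le> x" "x \<le> 0" "cmod (Qden N (Complex x y)) = 1"
    using IVT2'[of "\<lambda>x. cmod (Qden N (Complex x y))" 0 1 "-1"] 0 1 by auto
  then have "x < 0" using 0 by (cases "x = 0") auto
  then show ?thesis using x Qden_mono[OF N]
    by (metis less_eq_real_def linorder_neq_iff order_less_irrefl)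
qed

lemma wedge_iff:
  assumes N: "N \<in> {3, 4}"
  shows "Complex x y \<in> wedge N \<longleftrightarrow> 0 < \<bar>y\<bar> \<and> \<bar>y\<bar> < omega_star N \<and> x_b N y < x \<and> x \<le> 0"
proof (cases "0 < \<bar>y\<bar> \<and> \<bar>y\<bar> < omega_star N")
  case True
  have b: "x_b N y < 0 \<and> cmod (Qden N (Complex (x_b N y) y)) = 1"
    unfolding x_b_def using theI'[OF x_b_unique[OF N]] True by blast
  have "cmod (Qden N (Complex x y)) < 1 \<longleftrightarrow> x_b N y < x" if "x \<le> 0"
    using Qden_mono[OF N, of "x_b N y" x y] Qden_mono[OF N, of x "x_b N y" y] b that
    by (metis less_eq_real_def linorder_not_le order_less_asym order_less_irrefl)
  then show ?thesis using True by (auto simp: wedge_def)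
next
  case False
  then have "\<not> cmod (Qden N (Complex 0 y)) < 1" using Qden_axis[OF N] by simp
  then have "\<not> (x \<le> 0 \<and> cmod (Qden N (Complex x y)) < 1)"
    using Qden_mono[OF N, of x 0 y] by (cases "x = 0") auto
  then show ?thesis using False by (auto simp: wedge_def)
qed

lemma wedge_weight_exists:
  assumes N: "N \<in> {3, 4}"
  shows "\<exists>\<theta>. wedge_weight N \<theta>"
proof -
  let ?o = "omega_star N" and ?d = "pad_width"
  define \<theta> where "\<theta> z = (let x = Re z; y = Im z; b = x_b N y in
     if z = 0 \<or> z \<in> wedge N then 1
     else if 0 < \<bar>y\<bar> \<and> \<bar>y\<bar> < ?o \<and> (1 + ?d) * b \<le> x \<and> x \<le> b then ((1 + ?d) * b - x) / (?d * b)
     else if x = 0 \<and> ?o \<le> \<bar>y\<bar> \<and> \<bar>y\<bar> \<le> (1 + ?d) * ?o then ((1 + ?d) * ?o - \<bar>y\<bar>) / (?d * ?o)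
     else 0)" for z
  have o: "?o > 0" by (simp add: omega_star_def)
  have b: "x_b N y < 0" if "0 < \<bar>y\<bar>" "\<bar>y\<bar> < ?o" for y
    unfolding x_b_def using theI'[OF x_b_unique[OF N that]] by blast
  have W: "Complex x y \<in> wedge N \<longleftrightarrow> 0 < \<bar>y\<bar> \<and> \<bar>y\<bar> < ?o \<and> x_b N y < x \<and> x \<le> 0" for x y
    by (rule wedge_iff[OF N])
  have Z: "Complex x y = 0 \<longleftrightarrow> x = 0 \<and> y = 0" for x y by (simp add: complex_eq_iff)
  have all: "(\<forall>z. P z) \<longleftrightarrow> (\<forall>x y. P (Complex x y))" for P by (metis complex.exhaust)
  have d: "?d = 1/10" by (simp add: pad_width_def)
  have T: "\<theta> (Complex x y) = (
     if x = 0 \<and> y = 0 \<or> 0 < \<bar>y\<bar> \<and> \<bar>y\<bar> < ?o \<and> x_b N y < x \<and> x \<le> 0 then 1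
     else if 0 < \<bar>y\<bar> \<and> \<bar>y\<bar> < ?o \<and> (1 + ?d) * x_b N y \<le> x \<and> x \<le> x_b N y
       then ((1 + ?d) * x_b N y - x) / (?d * x_b N y)
     else if x = 0 \<and> ?o \<le> \<bar>y\<bar> \<and> \<bar>y\<bar> \<le> (1 + ?d) * ?o then ((1 + ?d) * ?o - \<bar>y\<bar>) / (?d * ?o)
     else 0)" for x y
    unfolding \<theta>_def Let_def W Z by simp
  have 1: "0 \<le> \<theta> (Complex x y) \<and> \<theta> (Complex x y) \<le> 1" for x y
    unfolding T using o b[of y] by (auto simp: d divide_simps)
  have 2: "\<theta> z = 1" if "z \<in> insert 0 (wedge N)" for z using that by (auto simp: \<theta>_def Let_def)
  have 3: "\<theta> (Complex x y) = ((1 + ?d) * x_b N y - x) / (?d * x_b N y)"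
    if "0 < \<bar>y\<bar> \<and> \<bar>y\<bar> < ?o \<and> (1 + ?d) * x_b N y \<le> x \<and> x \<le> x_b N y" for x y
    unfolding T using that by auto
  have 4: "\<theta> (Complex 0 y) = 1" if "\<bar>y\<bar> = ?o" for y
    unfolding T using that o by (auto simp: d field_simps)
  have 5: "\<theta> (Complex x y) = \<theta> (Complex x (sgn y * ?o)) * (((1 + ?d) * ?o - \<bar>y\<bar>) / (?d * ?o))"
    if "x \<le> 0 \<and> ?o \<le> \<bar>y\<bar> \<and> \<bar>y\<bar> \<le> (1 + ?d) * ?o" for x y
    unfolding T using that o by (auto simp: d sgn_if abs_mult)
  have 6: "\<theta> (Complex x y) = 0" if h: "x > 0 \<or> \<bar>y\<bar> \<ge> (1 + ?d) * ?o \<or> y = 0 \<and> Complex x y \<noteq> 0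
     \<or> 0 < \<bar>y\<bar> \<and> \<bar>y\<bar> < ?o \<and> x \<le> (1 + ?d) * x_b N y
     \<or> x < 0 \<and> (\<forall>y. 0 < \<bar>y\<bar> \<and> \<bar>y\<bar> < ?o \<longrightarrow> x \<le> (1 + ?d) * x_b N y)" for x y
  proof -
    consider "x > 0" | "\<bar>y\<bar> \<ge> (1 + ?d) * ?o" | "y = 0" "x \<noteq> 0"
      | "0 < \<bar>y\<bar>" "\<bar>y\<bar> < ?o" "x \<le> (1 + ?d) * x_b N y"
      | "\<not> (0 < \<bar>y\<bar> \<and> \<bar>y\<bar> < ?o)" "x < 0"
      using h Z by metis
    then show ?thesis
      unfolding T using o b[of y] by cases (auto simp: d)
  qed
  have 1: "\<forall>z. 0 \<le> \<theta> z \<and> \<theta> z \<le> 1" using 1 by (metis complex.exhaust)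
  have 6: "\<forall>z. Re z > 0 \<or> \<bar>Im z\<bar> \<ge> (1 + ?d) * ?o \<or> Im z = 0 \<and> z \<noteq> 0
     \<or> 0 < \<bar>Im z\<bar> \<and> \<bar>Im z\<bar> < ?o \<and> Re z \<le> (1 + ?d) * x_b N (Im z)
     \<or> Re z < 0 \<and> (\<forall>y. 0 < \<bar>y\<bar> \<and> \<bar>y\<bar> < ?o \<longrightarrow> Re z \<le> (1 + ?d) * x_b N y) \<longrightarrow> \<theta> z = 0"
  proof (intro allI impI)
    fix z assume "Re z > 0 \<or> \<bar>Im z\<bar> \<ge> (1 + ?d) * ?o \<or> Im z = 0 \<and> z \<noteq> 0
     \<or> 0 < \<bar>Im z\<bar> \<and> \<bar>Im z\<bar> < ?o \<and> Re z \<le> (1 + ?d) * x_b N (Im z)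
     \<or> Re z < 0 \<and> (\<forall>y. 0 < \<bar>y\<bar> \<and> \<bar>y\<bar> < ?o \<longrightarrow> Re z \<le> (1 + ?d) * x_b N y)"
    then show "\<theta> z = 0" using 6[of "Re z" "Im z"] unfolding complex_surj by blast
  qed
  have "wedge_weight N \<theta>" unfolding wedge_weight_def
    by (intro conjI 1 6; use 2 3 4 5 in blast)
  then show ?thesis by blast
qed

lemma arg_branch_exists:
  assumes f0: "f 0 = 1" and c: "continuous_on (arg_domain f) f"
  shows "\<exists>A. arg_branch f A"
proof -
  let ?S = "arg_domain f"
  have "\<exists>a\<in>?S. \<forall>x\<in>?S. closed_segment a x \<subseteq> ?S"
  proof (intro bexI ballI subsetI)
    fix x w assume x: "x \<in> ?S" and "w \<in> closed_segment 0 x"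
    then obtain u where u: "0 \<le> u" "u \<le> 1" "w = of_real u * x"
      by (auto simp: closed_segment_def scaleR_conv_of_real)
    show "w \<in> ?S" unfolding arg_domain_def
    proof (safe)
      fix t :: real assume "t \<in> {0..1}" "f (of_real t * w) = 0"
      moreover have "t * u \<in> {0..1}" using u \<open>t \<in> {0..1}\<close> by (auto intro: mult_le_one)
      ultimately show False using x u by (auto simp: arg_domain_def mult.assoc[symmetric] simp flip: of_real_mult)
    qed
  qed (use f0 in \<open>auto simp: arg_domain_def\<close>)
  then have "contractible ?S" by (intro starlike_imp_contractible) (auto simp: starlike_def)
  moreover have "f z \<noteq> 0" if "z \<in> ?S" for z
    using that by (auto simp: arg_domain_def dest: bspec[of _ _ 1])
  ultimately obtain g where g: "continuous_on ?S g" "\<And>z. z \<in> ?S \<Longrightarrow> f z = exp (g z)"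
    using continuous_logarithm_on_contractible[OF c] by metis
  have 0: "0 \<in> ?S" using f0 by (auto simp: arg_domain_def)
  define A where "A z = Im (g z) - Im (g 0)" for z
  have e0: "exp (g 0) = 1" using g 0 f0 by metis
  then have r0: "Re (g 0) = 0" by (metis norm_exp_eq_Re norm_one ln_exp ln_one)
  have "exp (\<i> * of_real (Im (g 0))) = exp (g 0)" using r0 by (intro arg_cong[of _ _ exp]) (auto simp: complex_eq_iff)
  then have e1: "exp (\<i> * of_real (Im (g 0))) = 1" using e0 by simp
  have "f z = of_real (cmod (f z)) * exp (\<i> * of_real (A z))" if "z \<in> ?S" for z
  proof -
    have "exp (\<i> * of_real (A z)) = exp (\<i> * of_real (Im (g z)))"
      unfolding A_def using e1 by (simp add: right_diff_distrib exp_diff)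
    moreover have "exp (g z) = of_real (exp (Re (g z))) * exp (\<i> * of_real (Im (g z)))"
      by (metis exp_of_real mult_exp_exp complex_eq)
    ultimately show ?thesis using g(2)[OF that] by (simp add: norm_mult)
  qed
  moreover have "continuous_on ?S A" unfolding A_def using g by (intro continuous_intros) auto
  moreover have "A 0 = 0" by (simp add: A_def)
  ultimately show ?thesis unfolding arg_branch_def by blast
qed

end

theory Submission
  imports Defs
begin

text \<open>
  The taper is 1 beyond the cutoff, so everything reduces to the decay of the dissipative parent.
  The wedge boundary satisfies \<open>x_b N y \<ge> -1\<close>, so the pad lies in a bounded set; outside it the
  repaired map is \<open>[0/N]\<close>, a constant divided by a polynomial of degree \<open>N > 0\<close>. The only fact
  needed about Pade approximants is that \<open>[0/N]\<close> exists, so that the choice operator in \<open>pade\<close>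
  returns a pair of the right degrees.
\<close>

lemma is_pade_zero_exists: "\<exists>Q. is_pade 0 N 1 Q"
proof -
  define Q :: "complex poly" where "Q = (\<Sum>j\<le>N. monom ((- 1) ^ j / fact j) j)"
  have poly_Q: "poly Q z = (\<Sum>j\<le>N. (- z) ^ j / fact j)" for z
    unfolding Q_def by (simp add: poly_sum poly_monom power_minus[of z])
  have coeff_Q: "coeff Q k = (if k \<le> N then (- 1) ^ k / fact k else 0)" for k
    by (simp add: Q_def coeff_sum)
  have "degree Q = N"
    by (intro antisym degree_le le_degree) (auto simp: coeff_Q)
  moreover have Q0: "poly Q 0 = 1"
    by (simp add: poly_0_coeff_0 coeff_Q)
  \<comment> \<open>\<open>1 / Q z - exp z = (exp z / Q z) (exp (- z) - Q z)\<close>, and \<open>Q\<close> is the Taylor polynomial of \<open>exp (- z)\<close>.\<close>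
  moreover have "(\<lambda>z. 1 / poly Q z - exp z) \<in> O[at 0](\<lambda>z. z ^ (N + 1))"
  proof -
    have "((\<lambda>z. exp z / poly Q z) \<longlongrightarrow> 1) (at 0)"
      by (rule tendsto_eq_intros refl | simp add: Q0)+
    then have big1: "(\<lambda>z. exp z / poly Q z) \<in> O[at 0](\<lambda>z. 1)"
      by (intro bigoI_tendsto[of _ _ 1]) auto
    \<comment> \<open>The remainder bound \<open>Taylor_exp\<close> carries the factor
      \<open>exp \<bar>Re z\<bar>\<close>; it is bounded near 0 and so does not affect the
      order.\<close>
    have "((\<lambda>z. of_real (exp \<bar>Re z\<bar>)) \<longlongrightarrow> (1::complex)) (at 0)"
      by (rule tendsto_eq_intros refl | simp)+
    then have big2: "(\<lambda>z. of_real (exp \<bar>Re z\<bar>)) \<in> O[at 0](\<lambda>z. 1 :: complex)"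
      by (intro bigoI_tendsto[of _ _ 1]) auto
    have "(\<lambda>z. exp (- z) - poly Q z) \<in> O[at 0](\<lambda>z. of_real (exp \<bar>Re z\<bar>) * z ^ (N + 1))"
    proof (rule bigoI[of _ "1 / fact N"], rule always_eventually, rule allI)
      fix z :: complex
      show "norm (exp (- z) - poly Q z) \<le> 1 / fact N * norm (of_real (exp \<bar>Re z\<bar>) * z ^ (N + 1))"
        using Taylor_exp[of "- z" N] by (simp add: poly_Q norm_mult norm_power field_simps)
    qed
    also have "(\<lambda>z. of_real (exp \<bar>Re z\<bar>) * z ^ (N + 1)) \<in> O[at 0](\<lambda>z. 1 * z ^ (N + 1) :: complex)"
      by (rule landau_o.big.mult[OF big2]) simp
    finally have "(\<lambda>z. exp z / poly Q z * (exp (- z) - poly Q z)) \<in> O[at 0](\<lambda>z. 1 * (1 * z ^ (N + 1)))"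
      by (rule landau_o.big.mult[OF big1])
    then have "(\<lambda>z. exp z / poly Q z * (exp (- z) - poly Q z)) \<in> O[at 0](\<lambda>z. z ^ (N + 1))"
      by simp
    \<comment> \<open>At a zero of \<open>Q\<close>, division by zero would break the factorisation,
      so such points must be kept away from 0.\<close>
    moreover have "eventually (\<lambda>z. poly Q z \<noteq> 0) (at 0)"
      by (rule tendsto_imp_eventually_ne[of _ 1]) (rule tendsto_eq_intros refl | simp add: Q0)+
    then have "eventually (\<lambda>z. exp z / poly Q z * (exp (- z) - poly Q z) = 1 / poly Q z - exp z) (at 0)"
      by eventually_elim (simp add: field_simps flip: exp_add)
    ultimately show ?thesis
      using landau_o.big.in_cong by fastforce
  qed
  ultimately show ?thesis
    by (auto simp: is_pade_def)
qed

lemma tendsto_pade_zero_at_infinity: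
  assumes "N > 0"
  shows "(pade 0 N \<longlongrightarrow> 0) at_infinity"
proof -
  have "\<exists>PQ. is_pade 0 N (fst PQ) (snd PQ)"
    using is_pade_zero_exists by fastforce
  moreover obtain P Q where PQ: "(SOME PQ. is_pade 0 N (fst PQ) (snd PQ)) = (P, Q)"
    by force
  ultimately have "is_pade 0 N P Q"
    by (metis (lifting) fst_conv snd_conv someI_ex)
  then have "degree P < degree Q"
    using assms by (simp add: is_pade_def)
  then show ?thesis
    unfolding pade_def PQ prod.case by (rule poly_divide_tendsto_0_at_infinity)
qed

text \<open>For x = -1 the expansion of |Q_N|^2 in \<open>Qden_sq\<close> has constant and linear
  terms summing to at least 1 and nonnegative remaining terms. So -1 + iy lies outside the wedge,
  whose slice at height y is \<open>x_b N y\<close> < x \<le> 0.\<close>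

lemma x_b_ge:
  assumes N: "N \<in> {3, 4}" and y: "0 < \<bar>y\<bar>" "\<bar>y\<bar> < omega_star N"
  shows "-1 \<le> x_b N y"
proof -
  have "1 \<le> (cmod (Qden N (Complex (-1) y)))\<^sup>2"
    using lin_coeff_bound[of y] const_coeff_bounds[of y] N Qden_sq[of 1 y]
    by (auto simp: add_increasing add_increasing2)
  then have "Complex (-1) y \<notin> wedge N"
    by (auto simp: wedge_def abs_square_less_1 simp flip: linorder_not_less)
  then show ?thesis
    using wedge_iff[OF N] y by auto
qed

text \<open>The radius 5 suffices because the pad lies in |Im z| \<le> 1.1 * 3 and Re z \<ge> -1.1:
  below that height, |z| \<ge> 5 forces Re z \<le> -1.7.\<close>

lemma wedge_weight_eq_0:
  assumes N: "N \<in> {3, 4}" and W: "wedge_weight N \<theta>" and z: "Re z \<le> 0" "cmod z \<ge> 5"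
  shows "\<theta> z = 0"
proof (cases "\<bar>Im z\<bar> \<ge> (1 + pad_width) * omega_star N")
  case False
  have "omega_star N \<le> 3"
    by (auto simp: omega_star_def intro!: real_le_lsqrt)
  then have "\<bar>Im z\<bar> \<le> 33 / 10"
    using False by (simp add: pad_width_def)
  then have "Re z \<le> - (11 / 10)"
    using cmod_le[of z] z by linarith
  moreover have "- (11 / 10) \<le> (1 + pad_width) * x_b N y" if "0 < \<bar>y\<bar>" "\<bar>y\<bar> < omega_star N" for y
    using x_b_ge[OF N that] by (simp add: pad_width_def)
  \<comment> \<open>Comparing with the outer edge at all heights y also covers
    \<open>omega_star N\<close> \<le> |Im z|, where \<open>x_b\<close> at the height of z itself
    gives no information.\<close>
  ultimately have "Re z < 0 \<and> (\<forall>y. 0 < \<bar>y\<bar> \<and> \<bar>y\<bar> < omega_star N \<longrightarrow> Re z \<le> (1 + pad_width) * x_b N y)"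
    by fastforce
  then show ?thesis
    using W unfolding wedge_weight_def by blast
qed (use W in \<open>unfold wedge_weight_def, blast\<close>)

lemma repaired_map_eq_pade:
  assumes "N \<in> {3, 4}" "repaired_map N R a" "Re z \<le> 0" "cmod z \<ge> 5"
  shows "R z = pade 0 N z"
proof -
  obtain \<theta> a_raw a_fix where W: "wedge_weight N \<theta>"
    and R: "R = blend \<theta> (pade 1 (N - 1)) a_fix (pade 0 N) a_raw"
    using assms(2) by (auto simp: repaired_map_def)
  show ?thesis
    unfolding R blend_def using wedge_weight_eq_0[OF assms(1) W assms(3,4)] by simp
qed

text \<open>Serves with b = 5 for the pad and with b = \<open>\<omega>\<^sub>c\<close> for the
  taper.\<close>

lemma eventually_at_infinity_left_half_plane:
  "(\<And>z. Re z \<le> 0 \<Longrightarrow> b \<le> cmod z \<Longrightarrow> P z) \<Longrightarrow> eventually P (inf at_infinity (principal {z. Re z \<le> 0}))"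
  unfolding eventually_inf_principal eventually_at_infinity by blast

lemma tendsto_repaired_map:
  assumes N: "N \<in> {3, 4}" and R: "repaired_map N R a"
  shows "(R \<longlongrightarrow> 0) (inf at_infinity (principal {z. Re z \<le> 0}))"
proof -
  have "eventually (\<lambda>z. R z = pade 0 N z) (inf at_infinity (principal {z. Re z \<le> 0}))"
    by (rule eventually_at_infinity_left_half_plane) (rule repaired_map_eq_pade[OF N R])
  moreover have "(pade 0 N \<longlongrightarrow> 0) (inf at_infinity (principal {z. Re z \<le> 0}))"
    by (rule tendsto_mono[OF inf_le1 tendsto_pade_zero_at_infinity]) (use N in auto)
  ultimately show ?thesis
    by (simp add: tendsto_cong)
qed

lemma tendsto_dissipative_parent:
  assumes "dissipative_parent M R a"
  shows "(R \<longlongrightarrow> 0) (inf at_infinity (principal {z. Re z \<le> 0}))"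
  using assms tendsto_mono[OF inf_le1 tendsto_pade_zero_at_infinity[of 2]]
  by (cases M) (auto intro: tendsto_repaired_map)

theorem proposition5p5:
  fixes M :: scheme and r \<omega>\<^sub>c :: real and s :: nat and R R_D :: "complex \<Rightarrow> complex"
  assumes "0 < r" and "r < 1" and "s > 1" and "\<omega>\<^sub>c > 0"
    and "amplification_map M r s \<omega>\<^sub>c R_D R"
  shows "(\<forall>z. cmod z \<ge> \<omega>\<^sub>c \<longrightarrow> R z = R_D z) \<and>
         (R \<longlongrightarrow> 0) (inf at_infinity (principal {z. Re z \<le> 0}))"
proof -
  obtain a_D a_C where D: "dissipative_parent M R_D a_D"
    and R: "R = blend (\<lambda>z. taper r s \<omega>\<^sub>c (cmod z)) R_D a_D (conservative_parent M) a_C"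
    using assms by (auto simp: amplification_map_def)
  \<comment> \<open>Rules out the first branch of \<open>taper\<close>, which is tested before the
    others, for all |z| \<ge> \<open>\<omega>\<^sub>c\<close>.\<close>
  have "r * \<omega>\<^sub>c < \<omega>\<^sub>c"
    using assms by simp
  then have eq: "R z = R_D z" if "cmod z \<ge> \<omega>\<^sub>c" for z
    using that by (simp add: R blend_def taper_def)
  then have "eventually (\<lambda>z. R z = R_D z) (inf at_infinity (principal {z. Re z \<le> 0}))"
    by (rule eventually_at_infinity_left_half_plane)
  then have "(R \<longlongrightarrow> 0) (inf at_infinity (principal {z. Re z \<le> 0}))"
    using tendsto_dissipative_parent[OF D] by (simp add: tendsto_cong)
  then show ?thesis
    using eq by blast
qed

end
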